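(* Let $0<k<n$, and let $\hat J$ be the ideal of the polynomial ring $\mathrm K_T(pt)[[q]][e_1(z),\dots,e_k(z),e_1(\hat z),\dots,e_{n-k}(\hat z)]$ generated by $\sum_{i+j=\ell}e_i(z)e_j(\hat z)-\hat g_\ell(z,\zeta,q)$ for $1\le\ell\le n$ (so that the quotient is the Coulomb branch ring $\widehat{\mathrm{QK}}_T(\mathrm{Gr}(k;n))$). Then for $1\le\ell\le n-k$, $$e_\ell(\hat z)\equiv\sum_{i+j=\ell}(-1)^je_i(\zeta)G_j(z)=(-1)^\ell G'_\ell(z,\zeta)\mod\hat J.$$
   Context: $\mathrm K_T(pt)=\mathbb Z[T_1^{\pm1},\dots,T_n^{\pm1}]$, $\zeta_i=1-T_i$, $\zeta=(\zeta_1,\dots,\zeta_n)$; $z=(z_1,\dots,z_k)$, $\hat z=(\hat z_1,\dots,\hat z_{n-k})$ are formal variables. $e_i$, $h_i$, $s_\mu$ denote elementary symmetric, complete homogeneous symmetric and Schur polynomials ($e_0=h_0=1$; $e_i=0$ for $i<0$ or $i$ exceeding the number of variables). Grothendieck polynomials: $G_0(z)=1$ and, for $j\ge1$, $G_j(z)=h_j(z)-\sum_{a=2}^k(-1)^as_{(j,1^{a-1})}(z)$. Also $G'_j(z,\zeta)=\sum_{a+b=j}(-1)^ae_a(\zeta)G_b(z)$. Set $c^z_{\ge j}=\sum_{i\ge j}(-1)^{i-j}e_i(z)$, $c^\zeta_{\ge j}=\sum_{i\ge j}(-1)^{i-j}e_i(\zeta)$, $c^\zeta=\prod_{i=1}^n(1-\zeta_i)$,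 and $c'_{\ge\ell}(z,\zeta)=e_\ell(\zeta)+e_{\ell-1}(\zeta)c^z_{\ge2}+\dots+e_{\ell-k+1}(\zeta)c^z_{\ge k}$. Let $E$ be the $k\times k$ lower triangular matrix with $E_{ij}=-e_{i-j}(z)$ for $i\ge j$, and $C^\zeta_{\ge n-k+2}=(c^\zeta_{\ge n-k+2},\dots,c^\zeta_{\ge n},0)^t$. Then $\hat g_\ell(z,\zeta,q)=c'_{\ge\ell}(z,\zeta)$ for $1\le\ell\le n-k$, and $\hat g_\ell(z,\zeta,q)=c'_{\ge\ell}(z,\zeta)+(E\cdot C^\zeta_{\ge n-k+2})_{\ell-n+k}+(-1)^{n+k}q\binom{k-1}{n-\ell}c^\zeta$ for $n-k+1\le\ell\le n$. *)

theory Defs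
  imports
    "HOL-Algebra.Algebraic_Closure_Type"
    "HOL-Algebra.Generated_Rings"
    "HOL-Algebra.QuotRing"
    "HOL-Library.Poly_Mapping"
    "HOL-Library.Multiset"
    "HOL-Library.FuncSet"
    "HOL-Computational_Algebra.Formal_Power_Series"
begin

section \<open>Symmetric polynomials\<close>

text \<open>
  Symmetric polynomials in \<open>N\<close> variables are evaluated at the elements \<open>x 1, \<dots>, x N\<close> of an
  arbitrary commutative ring. The index of \<open>esym\<close> is an integer because negative indices
  occur, and there the value is \<open>0\<close>.
\<close>

definition esym :: "nat \<Rightarrow> int \<Rightarrow> (nat \<Rightarrow> 'a::comm_ring_1) \<Rightarrow> 'a" where
  "esym N i x = (\<Sum>S | S \<subseteq> {1..N} \<and> int (card S) = i. \<Prod>s\<in>S. x s)"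

definition hsym :: "nat \<Rightarrow> nat \<Rightarrow> (nat \<Rightarrow> 'a::comm_ring_1) \<Rightarrow> 'a" where
  "hsym N j x = (\<Sum>M\<in>multisets_of_size {1..N} j. \<Prod>s\<in>#M. x s)"

definition cells :: "nat list \<Rightarrow> (nat \<times> nat) set" where
  "cells \<mu> = {(r, c). r < length \<mu> \<and> c < \<mu> ! r}"

definition ssyt :: "nat \<Rightarrow> nat list \<Rightarrow> (nat \<times> nat \<Rightarrow> nat) set" where
  "ssyt N \<mu> = {T \<in> cells \<mu> \<rightarrow>\<^sub>E {1..N}.
     (\<forall>r c. (r, c) \<in> cells \<mu> \<and> (r, Suc c) \<in> cells \<mu> \<longrightarrow> T (r, c) \<le> T (r, Suc c)) \<and>
     (\<forall>r c. (r, c) \<in> cells \<mu> \<and> (Suc r, c) \<in> cells \<mu> \<longrightarrow> T (r, c) < T (Suc r, c))}"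

definition schur :: "nat \<Rightarrow> nat list \<Rightarrow> (nat \<Rightarrow> 'a::comm_ring_1) \<Rightarrow> 'a" where
  "schur N \<mu> x = (\<Sum>T\<in>ssyt N \<mu>. \<Prod>b\<in>cells \<mu>. x (T b))"

section \<open>Grothendieck polynomials\<close>

definition groth :: "nat \<Rightarrow> nat \<Rightarrow> (nat \<Rightarrow> 'a::comm_ring_1) \<Rightarrow> 'a" where
  "groth k j z = (if j = 0 then 1
     else hsym k j z - (\<Sum>a = 2..k. (-1) ^ a * schur k (j # replicate (a - 1) 1) z))"

definition groth' ::
  "nat \<Rightarrow> nat \<Rightarrow> nat \<Rightarrow> (nat \<Rightarrow> 'a::comm_ring_1) \<Rightarrow> (nat \<Rightarrow> 'a) \<Rightarrow> 'a" where
  "groth' n k j z \<zeta> =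
     (\<Sum>(a, b) | a + b = j. (-1) ^ a * esym n (int a) \<zeta> * groth k b z)"

section \<open>The right-hand sides of the relations\<close>

definition cge :: "nat \<Rightarrow> nat \<Rightarrow> (nat \<Rightarrow> 'a::comm_ring_1) \<Rightarrow> 'a" where
  "cge N j x = (\<Sum>i = j..N. (-1) ^ (i - j) * esym N (int i) x)"

definition cge' ::
  "nat \<Rightarrow> nat \<Rightarrow> nat \<Rightarrow> (nat \<Rightarrow> 'a::comm_ring_1) \<Rightarrow> (nat \<Rightarrow> 'a) \<Rightarrow> 'a" where
  "cge' n k l z \<zeta> =
     esym n (int l) \<zeta> + (\<Sum>m = 2..k. esym n (int l - int m + 1) \<zeta> * cge k m z)"

text \<open>Matrices and vectors are indexed from \<open>1\<close>: \<open>Cvec\<close> is the column vector of length \<open>k\<close> whose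
  entries are \<open>cge n j \<zeta>\<close> for \<open>j = n - k + 2, \<dots>, n\<close>, followed by \<open>0\<close>.\<close>

definition Emat :: "nat \<Rightarrow> (nat \<Rightarrow> 'a::comm_ring_1) \<Rightarrow> nat \<Rightarrow> nat \<Rightarrow> 'a" where
  "Emat k z i j = (if j \<le> i then - esym k (int i - int j) z else 0)"

definition Cvec :: "nat \<Rightarrow> nat \<Rightarrow> (nat \<Rightarrow> 'a::comm_ring_1) \<Rightarrow> nat \<Rightarrow> 'a" where
  "Cvec n k \<zeta> p = (if p < k then cge n (n - k + 1 + p) \<zeta> else 0)"

definition ghat ::
  "nat \<Rightarrow> nat \<Rightarrow> nat \<Rightarrow> (nat \<Rightarrow> 'a::comm_ring_1) \<Rightarrow> (nat \<Rightarrow> 'a) \<Rightarrow> 'a \<Rightarrow> 'a" where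
  "ghat n k l z \<zeta> q =
     (if l \<le> n - k then cge' n k l z \<zeta>
      else cge' n k l z \<zeta>
        + (\<Sum>p = 1..k. Emat k z (l - (n - k)) p * Cvec n k \<zeta> p)
        + (-1) ^ (n + k) * q * of_nat ((k - 1) choose (n - l)) * (\<Prod>i = 1..n. 1 - \<zeta> i))"

section \<open>The ring and the ideal\<close>

text \<open>
  The type \<open>laurent\<close> is the ring of integral Laurent polynomials in \<open>T 1, T 2, \<dots>\<close>, realised as
  the group ring of the free abelian group on the indices; \<open>KT n\<close> consists of those involving
  only \<open>T 1, \<dots>, T n\<close>. Likewise \<open>amb\<close> has infinitely many variables; \<open>QKpoly\<close> below
  only involves \<open>zvar 1, \<dots>, zvar k\<close> and \<open>zhat 1, \<dots>, zhat (n - k)\<close>.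
\<close>

type_synonym laurent = "(nat \<Rightarrow>\<^sub>0 int) \<Rightarrow>\<^sub>0 int"

datatype var = Z nat | Zhat nat

type_synonym amb = "(var \<Rightarrow>\<^sub>0 nat) \<Rightarrow>\<^sub>0 laurent fps"

definition KT :: "nat \<Rightarrow> laurent set" where
  "KT n = {f. \<forall>m\<in>Poly_Mapping.keys f. Poly_Mapping.keys m \<subseteq> {1..n}}"

definition Tvar :: "nat \<Rightarrow> laurent" where
  "Tvar i = Poly_Mapping.single (Poly_Mapping.single i 1) 1"

definition constp :: "laurent fps \<Rightarrow> amb" where
  "constp c = Poly_Mapping.single 0 c"

definition pvar :: "var \<Rightarrow> amb" where
  "pvar v = Poly_Mapping.single (Poly_Mapping.single v 1) 1"

definition zvar :: "nat \<Rightarrow> amb" where "zvar i = pvar (Z i)"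

definition zhat :: "nat \<Rightarrow> amb" where "zhat i = pvar (Zhat i)"

definition zeta :: "nat \<Rightarrow> amb" where "zeta i = constp (fps_const (1 - Tvar i))"

definition qpar :: amb where "qpar = constp fps_X"

text \<open>
  The polynomial ring in the \<open>e i (zvar)\<close> and \<open>e j (zhat)\<close> over the power series ring
  \<open>KT n [[q]]\<close>, as a subring of the polynomials in the variables \<open>zvar\<close> and \<open>zhat\<close> themselves.
\<close>

definition QKgens :: "nat \<Rightarrow> nat \<Rightarrow> amb set" where
  "QKgens n k = {constp c | c. \<forall>d. fps_nth c d \<in> KT n}
     \<union> {esym k (int i) zvar | i. i \<in> {1..k}}
     \<union> {esym (n - k) (int j) zhat | j. j \<in> {1..n - k}}"

definition QKpoly :: "nat \<Rightarrow> nat \<Rightarrow> amb ring" where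
  "QKpoly n k =
     ring_of_type_algebra \<lparr>carrier := generate_ring ring_of_type_algebra (QKgens n k)\<rparr>"

definition QKrel :: "nat \<Rightarrow> nat \<Rightarrow> nat \<Rightarrow> amb" where
  "QKrel n k l =
     (\<Sum>(i, j) | i + j = l. esym k (int i) zvar * esym (n - k) (int j) zhat)
       - ghat n k l zvar zeta qpar"

definition Jhat :: "nat \<Rightarrow> nat \<Rightarrow> amb set" where
  "Jhat n k = Idl\<^bsub>QKpoly n k\<^esub> {QKrel n k l | l. l \<in> {1..n}}"

definition cong_Jhat :: "nat \<Rightarrow> nat \<Rightarrow> amb \<Rightarrow> amb \<Rightarrow> bool" where
  "cong_Jhat n k a b \<longleftrightarrow>
     a \<in> carrier (QKpoly n k) \<and> b \<in> carrier (QKpoly n k) \<and> a - b \<in> Jhat n k"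

section \<open>Well-definedness of the ideal\<close>

text \<open>
  \<open>genideal\<close> is an intersection of ideals, hence only meaningful when the generators lie in
  the carrier.
\<close>

lemma cring_QKpoly: "cring (QKpoly n k)"
proof -
  interpret A: cring "ring_of_type_algebra :: amb ring"
    by (rule cring_from_type_algebra)
  have "subring (generate_ring ring_of_type_algebra (QKgens n k)) (ring_of_type_algebra :: amb ring)"
    by (rule A.generate_ring_is_subring) (simp add: ring_of_type_algebra_def)
  then have "subcring (generate_ring ring_of_type_algebra (QKgens n k)) (ring_of_type_algebra :: amb ring)"
    by (rule A.subcringI')
  then show ?thesis
    unfolding QKpoly_def by (rule A.subcring_iff[THEN iffD1, rotated])
      (simp add: ring_of_type_algebra_def)
qed

lemma QKpoly_ops [simp]:
  "a \<oplus>\<^bsub>QKpoly n k\<^esub> b = a + b" "a \<otimes>\<^bsub>QKpoly n k\<^esub> b = a * b"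
  "\<zero>\<^bsub>QKpoly n k\<^esub> = 0" "\<one>\<^bsub>QKpoly n k\<^esub> = 1"
  by (simp_all add: QKpoly_def ring_of_type_algebra_def)

context
  fixes n k :: nat
begin

lemma QKpoly_closed:
  shows C_gen: "g \<in> QKgens n k \<Longrightarrow> g \<in> carrier (QKpoly n k)"
    and C_zero: "0 \<in> carrier (QKpoly n k)" and C_one: "1 \<in> carrier (QKpoly n k)"
    and C_add: "a \<in> carrier (QKpoly n k) \<Longrightarrow> b \<in> carrier (QKpoly n k) \<Longrightarrow> a + b \<in> carrier (QKpoly n k)"
    and C_mult: "a \<in> carrier (QKpoly n k) \<Longrightarrow> b \<in> carrier (QKpoly n k) \<Longrightarrow> a * b \<in> carrier (QKpoly n k)"
proof -
  interpret cring "QKpoly n k" by (rule cring_QKpoly)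
  show "g \<in> QKgens n k \<Longrightarrow> g \<in> carrier (QKpoly n k)"
    by (simp add: QKpoly_def generate_ring.incl)
  show "0 \<in> carrier (QKpoly n k)" "1 \<in> carrier (QKpoly n k)" using zero_closed one_closed by auto
  show "a \<in> carrier (QKpoly n k) \<Longrightarrow> b \<in> carrier (QKpoly n k) \<Longrightarrow> a + b \<in> carrier (QKpoly n k)" using add.m_closed[of a b] by auto
  show "a \<in> carrier (QKpoly n k) \<Longrightarrow> b \<in> carrier (QKpoly n k) \<Longrightarrow> a * b \<in> carrier (QKpoly n k)" using m_closed[of a b] by auto
qed

lemma C_uminus:
  assumes "a \<in> carrier (QKpoly n k)" shows "- a \<in> carrier (QKpoly n k)"
proof -
  interpret cring "QKpoly n k" by (rule cring_QKpoly)
  have "a_inv (QKpoly n k) a \<in> carrier (QKpoly n k)" "a_inv (QKpoly n k) a + a = 0"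
    using assms l_neg[OF assms] by auto
  then show ?thesis by (metis eq_neg_iff_add_eq_0)
qed

lemma C_diff: "a \<in> carrier (QKpoly n k) \<Longrightarrow> b \<in> carrier (QKpoly n k) \<Longrightarrow> a - b \<in> carrier (QKpoly n k)"
  using C_add[OF _ C_uminus, of a b] by simp

lemma C_sum: "(\<And>i. i \<in> A \<Longrightarrow> f i \<in> carrier (QKpoly n k)) \<Longrightarrow> sum f A \<in> carrier (QKpoly n k)"
  by (induction A rule: infinite_finite_induct) (auto intro: C_zero C_add)

lemma C_prod: "(\<And>i. i \<in> A \<Longrightarrow> f i \<in> carrier (QKpoly n k)) \<Longrightarrow> prod f A \<in> carrier (QKpoly n k)"
  by (induction A rule: infinite_finite_induct) (auto intro: C_one C_mult)

lemma C_sign: "(-1) ^ m \<in> carrier (QKpoly n k)"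
  by (induction m) (auto intro: C_one C_mult C_uminus)

lemma C_of_nat: "of_nat m \<in> carrier (QKpoly n k)"
  by (induction m) (auto intro: C_zero C_one C_add)

lemma esym_0: "esym N 0 x = 1"
proof -
  have "{S. S \<subseteq> {1..N} \<and> int (card S) = 0} = {{}}"
    by (auto dest: finite_subset[OF _ finite_atLeastAtMost])
  then show ?thesis by (simp add: esym_def)
qed

lemma esym_outside:
  assumes "i < 0 \<or> i > int N" shows "esym N i x = 0"
proof -
  have "{S. S \<subseteq> {1..N} \<and> int (card S) = i} = {}"
    using assms by (auto dest!: card_mono[OF finite_atLeastAtMost])
  then show ?thesis by (simp only: esym_def sum.empty)
qed

lemma C_esym_z: "esym k i zvar \<in> carrier (QKpoly n k)"
proof (cases "1 \<le> i \<and> i \<le> int k")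
  case True
  then have "esym k (int (nat i)) zvar \<in> QKgens n k"
    unfolding QKgens_def by (intro UnI1 UnI2 CollectI exI[of _ "nat i"]) auto
  with True show ?thesis using C_gen by simp
next
  case False
  then consider "i = 0" | "i < 0 \<or> i > int k" by linarith
  then show ?thesis by cases (auto simp: esym_0 esym_outside intro: C_zero C_one)
qed

lemma C_esym_zhat: "esym (n - k) i zhat \<in> carrier (QKpoly n k)"
proof (cases "1 \<le> i \<and> i \<le> int (n - k)")
  case True
  then have "esym (n - k) (int (nat i)) zhat \<in> QKgens n k"
    unfolding QKgens_def by (intro UnI2 CollectI exI[of _ "nat i"]) auto
  with True show ?thesis using C_gen by simp
next
  case False
  then consider "i = 0" | "i < 0 \<or> i > int (n - k)" by linarith
  then show ?thesis by cases (auto simp: esym_0 esym_outside intro: C_zero C_one)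
qed

lemma C_const: "(\<And>d. fps_nth c d \<in> KT n) \<Longrightarrow> constp c \<in> carrier (QKpoly n k)"
  by (rule C_gen) (auto simp: QKgens_def)

lemma C_q: "qpar \<in> carrier (QKpoly n k)"
  unfolding qpar_def by (rule C_const) (auto simp: fps_X_def KT_def)

lemma C_zeta: "i \<in> {1..n} \<Longrightarrow> zeta i \<in> carrier (QKpoly n k)"
proof -
  assume i: "i \<in> {1..n}"
  have "Poly_Mapping.keys (1 - Tvar i) \<subseteq> {0, Poly_Mapping.single i 1}"
    using keys_diff[of 1 "Tvar i"] by (auto simp: Tvar_def)
  then have "1 - Tvar i \<in> KT n" using i by (auto simp: KT_def)
  moreover have "0 \<in> KT n" by (simp add: KT_def)
  ultimately show ?thesis unfolding zeta_def by (intro C_const) (auto simp: fps_const_def)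
qed

lemma C_esym_zeta: "esym n i zeta \<in> carrier (QKpoly n k)"
  unfolding esym_def by (intro C_sum C_prod C_zeta) auto

lemma QKrel_in_carrier: "QKrel n k l \<in> carrier (QKpoly n k)"
  unfolding QKrel_def ghat_def cge'_def cge_def Emat_def Cvec_def
  by (auto simp only: case_prod_beta split: if_split
      intro!: C_sum C_prod C_diff C_add C_mult C_uminus C_sign C_of_nat C_zero C_one C_q C_zeta
        C_esym_z C_esym_zhat C_esym_zeta)

lemma ideal_Jhat: "ideal (Jhat n k) (QKpoly n k)"
proof -
  interpret cring "QKpoly n k" by (rule cring_QKpoly)
  show ?thesis unfolding Jhat_def by (rule genideal_ideal) (auto intro: QKrel_in_carrier)
qed

end

end

theory Submission
  imports Defs
begin

text \<open>
  Write \<open>E(t)\<close>, \<open>F(t)\<close> and \<open>Z(t)\<close> for the generating functions of the elementary symmetric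
  polynomials in \<open>z\<close>, in the dual variables and in \<open>\<zeta>\<close>. In the degrees \<open>l \<le> n - k\<close> the relations
  have neither the matrix term nor the term with \<open>q\<close>, and they say that \<open>E(t) F(t)\<close> and
  \<open>C(t) Z(t)\<close> have the same coefficients modulo the ideal, where \<open>C(t)\<close> has the constant term \<open>1\<close>
  and the coefficients \<open>cge k (p + 1) z\<close> at \<open>t\<^sup>p\<close> for \<open>p > 0\<close> (lemma \<open>cge'_eq_coeff\<close>).

  Let \<open>G(t)\<close> be the generating function of the Grothendieck polynomials. The heart of the proof is
  the identity \<open>E(t) G(-t) = C(t)\<close> (lemma \<open>esym_fps_times_groth_fps\<close>). It turns the relations
  into \<open>E(t) (F(t) - Z(t) G(-t)) \<equiv> 0\<close> in degrees up to \<open>n - k\<close>. As \<open>E(t)\<close> has the constant term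
  \<open>1\<close>, dividing by it degree by degree yields \<open>F(t) \<equiv> Z(t) G(-t)\<close> in these degrees, which is the
  claimed congruence (lemma \<open>fps_division_closed\<close>).

  For the identity, Pieri's rule \<open>e\<^sub>a h\<^sub>j = s\<^bsub>(j+1,1\<^sup>a\<^sup>-\<^sup>1)\<^esub> + s\<^bsub>(j,1\<^sup>a)\<^esub>\<close> is summed with signs over \<open>a\<close>.
  The hook Schur polynomials assemble to Grothendieck polynomials and give
  \<open>G\<^sub>j - G\<^bsub>j+1\<^esub> = c h\<^sub>j\<close> with \<open>c = \<Sum>\<^sub>i (-1)\<^sup>i e\<^sub>i(z)\<close>, that is,
  \<open>(1 + t) G(-t) = 1 + c t H(-t)\<close>. In a fixed degree, the alternating sum of all
  products \<open>e\<^sub>a h\<^sub>j\<close> telescopes by the same rule, so that \<open>H(-t) E(t) = 1\<close>.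
  Hence \<open>(1 + t) E(t) G(-t) = E(t) + c t\<close>, and a comparison of coefficients shows that \<open>(1 + t) C(t)\<close> is the same series.
\<close>

section \<open>Hook Schur polynomials and Pieri's rule\<close>

text \<open>
  This is the Schur polynomial of the hook with arm length \<open>p\<close> and with \<open>a\<close> rows: \<open>M\<close> is the first
  row of a tableau without its corner, \<open>S\<close> is the first column. A row increases weakly and a column
  strictly, so a multiset and a set determine the tableau, and the only condition that links them is
  that the corner, the least element of \<open>S\<close>, is at most every entry of the arm. For \<open>a = 0\<close> there
  is no corner and the value is \<open>0\<close>; this convention lets the boundary terms of the sums below
  vanish.
\<close>

definition hook_sum :: "nat \<Rightarrow> nat \<Rightarrow> nat \<Rightarrow> (nat \<Rightarrow> 'a::comm_ring_1) \<Rightarrow> 'a" where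
  "hook_sum N p a x =
     (\<Sum>(M, S) | M \<in> multisets_of_size {1..N} p \<and> S \<subseteq> {1..N} \<and> card S = a
        \<and> (\<exists>s\<in>S. \<forall>m\<in>#M. s \<le> m). (\<Prod>m\<in>#M. x m) * (\<Prod>s\<in>S. x s))"

lemma esym_nat: "esym N (int a) x = (\<Sum>S | S \<subseteq> {1..N} \<and> card S = a. \<Prod>s\<in>S. x s)"
  by (simp add: esym_def)

lemma hook_sum_0_right: "hook_sum N p 0 x = 0"
proof -
  have "S = {}" if "S \<subseteq> {1..N}" "card S = 0" for S
    using that finite_subset[OF that(1)] by auto
  then have "{(M, S). M \<in> multisets_of_size {1..N} p \<and> S \<subseteq> {1..N} \<and> card S = 0
        \<and> (\<exists>s\<in>S. \<forall>m\<in>#M. s \<le> m)} = {}" by blast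
  then show ?thesis by (simp only: hook_sum_def sum.empty)
qed

lemma hook_sum_eq_0:
  assumes "N < a" shows "hook_sum N p a x = 0"
proof -
  have "card S \<noteq> a" if "S \<subseteq> {1..N}" for S
    using card_mono[OF _ that] assms by simp
  then have "{(M, S). M \<in> multisets_of_size {1..N} p \<and> S \<subseteq> {1..N} \<and> card S = a
        \<and> (\<exists>s\<in>S. \<forall>m\<in>#M. s \<le> m)} = {}" by blast
  then show ?thesis by (simp only: hook_sum_def sum.empty)
qed

lemma finite_pairs:
  "finite {(M, S). M \<in> multisets_of_size {1..N::nat} p \<and> S \<subseteq> {1..N} \<and> card S = a}"
  by (rule finite_subset[of _ "multisets_of_size {1..N} p \<times> Pow {1..N}"])
     (auto intro: finite_multisets_of_size)

lemma hsym_times_esym: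
  "hsym N p x * esym N (int a) x =
     (\<Sum>(M, S) | M \<in> multisets_of_size {1..N} p \<and> S \<subseteq> {1..N} \<and> card S = a.
        (\<Prod>m\<in>#M. x m) * (\<Prod>s\<in>S. x s))"
  unfolding hsym_def esym_nat sum_product sum.cartesian_product
  by (rule sum.cong) auto

lemma hsym_0: "hsym N 0 x = 1"
proof -
  have "multisets_of_size {1..N} 0 = {{#}}" by (auto simp: multisets_of_size_def)
  then show ?thesis by (simp add: hsym_def)
qed

lemma hook_sum_0_left:
  assumes "0 < a" shows "hook_sum N 0 a x = esym N (int a) x"
proof -
  have "(\<exists>s\<in>S. \<forall>m\<in>#M. s \<le> m) \<longleftrightarrow> True"
    if "M \<in> multisets_of_size {1..N} 0" "card S = a" for M S
    using that assms by (cases "S = {}") (auto simp: multisets_of_size_def)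
  then have "hook_sum N 0 a x = hsym N 0 x * esym N (int a) x"
    unfolding hsym_times_esym hook_sum_def by (intro sum.cong) auto
  then show ?thesis by (simp add: hsym_0)
qed

text \<open>
  Pieri's rule for hooks. The product is a sum over all pairs of a multiset \<open>M\<close> of size \<open>p + 1\<close> and
  a set \<open>S\<close> of size \<open>a\<close>. If some element of \<open>S\<close> is at most every element of \<open>M\<close>, then \<open>(M, S)\<close> is
  a hook already. Otherwise the least element of \<open>M\<close> is smaller than all of \<open>S\<close>, and moving it
  from \<open>M\<close> to \<open>S\<close> makes it the corner of a hook whose arm is shorter by one; moving the corner back
  is the inverse.
\<close>

lemma hsym_times_esym_hook:
  "hsym N (Suc p) x * esym N (int a) x = hook_sum N (Suc p) a x + hook_sum N p (Suc a) x"
proof -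
  let ?w = "\<lambda>(M, S). (\<Prod>m\<in>#M. x m) * (\<Prod>s\<in>S. x s)"
  let ?P = "\<lambda>p a. {(M, S). M \<in> multisets_of_size {1..N} p \<and> S \<subseteq> {1..N} \<and> card S = a}"
  let ?A = "\<lambda>p a. {(M, S). M \<in> multisets_of_size {1..N} p \<and> S \<subseteq> {1..N} \<and> card S = a
        \<and> (\<exists>s\<in>S. \<forall>m\<in>#M. s \<le> m)}"
  have "sum ?w (?P (Suc p) a) = sum ?w (?A (Suc p) a) + sum ?w (?P (Suc p) a - ?A (Suc p) a)"
    by (subst sum.subset_diff[of "?A (Suc p) a"]) (auto simp: add.commute intro: finite_pairs)
  also have "sum ?w (?P (Suc p) a - ?A (Suc p) a) = sum ?w (?A p (Suc a))"
  proof (rule sum.reindex_bij_witness[where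
        j = "\<lambda>(M, S). (M - {#Min_mset M#}, insert (Min_mset M) S)" and
        i = "\<lambda>(M, S). (add_mset (Min S) M, S - {Min S})"])
    fix q assume "q \<in> ?P (Suc p) a - ?A (Suc p) a"
    moreover obtain M S where q: "q = (M, S)" by (cases q)
    ultimately have M: "set_mset M \<subseteq> {1..N}" "size M = Suc p"
      and S: "S \<subseteq> {1..N}" "card S = a" and *: "\<forall>s\<in>S. \<exists>m\<in>#M. m < s"
      by (auto simp: multisets_of_size_def not_le)
    have fin: "finite S" using S finite_subset by blast
    have in_M: "Min_mset M \<in># M" using M by (intro Min_in) auto
    have le_M: "Min_mset M \<le> m" if "m \<in># M" for m using that by simp
    have lt_S: "Min_mset M < s" if "s \<in> S" for s using * that le_M by (meson le_less_trans)
    have notin: "Min_mset M \<notin> S" using lt_S by blast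
    have Min_eq: "Min (insert (Min_mset M) S) = Min_mset M"
      using fin lt_S by (intro Min_eqI) (auto simp: less_imp_le)
    show "(case (case q of (M, S) \<Rightarrow> (M - {#Min_mset M#}, insert (Min_mset M) S)) of
        (M, S) \<Rightarrow> (add_mset (Min S) M, S - {Min S})) = q"
      using in_M notin unfolding q by (simp add: Min_eq)
    show "(case q of (M, S) \<Rightarrow> (M - {#Min_mset M#}, insert (Min_mset M) S)) \<in> ?A p (Suc a)"
      using M S in_M notin fin le_M unfolding q
      by (auto simp: multisets_of_size_def size_Diff_singleton dest: in_diffD)
    show "?w (case q of (M, S) \<Rightarrow> (M - {#Min_mset M#}, insert (Min_mset M) S)) = ?w q"
    proof -
      have "(\<Prod>m\<in>#M. x m) = x (Min_mset M) * (\<Prod>m\<in>#M - {#Min_mset M#}. x m)"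
        using in_M by (metis insert_DiffM image_mset_add_mset prod_mset.add_mset)
      then show ?thesis unfolding q using fin notin by (simp add: mult_ac)
    qed
  next
    fix q assume "q \<in> ?A p (Suc a)"
    then obtain M S s where q: "q = (M, S)" and M: "set_mset M \<subseteq> {1..N}" "size M = p"
      and S: "S \<subseteq> {1..N}" "card S = Suc a" and s: "s \<in> S" "\<And>m. m \<in># M \<Longrightarrow> s \<le> m"
      by (auto simp: multisets_of_size_def)
    have fin: "finite S" using S finite_subset by blast
    have in_S: "Min S \<in> S" using fin s(1) by (intro Min_in) auto
    have le_S: "Min S \<le> t" if "t \<in> S" for t using that fin by simp
    have le_M: "Min S \<le> m" if "m \<in># M" for m using le_S[OF s(1)] s(2)[OF that] by simp
    have Min_eq: "Min_mset (add_mset (Min S) M) = Min S"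
      using le_M by (intro Min_eqI) auto
    show "(case (case q of (M, S) \<Rightarrow> (add_mset (Min S) M, S - {Min S})) of
        (M, S) \<Rightarrow> (M - {#Min_mset M#}, insert (Min_mset M) S)) = q"
      using in_S unfolding q prod.case Min_eq by auto
    \<comment> \<open>the moved corner is smaller than the rest of the column, so the new pair is not a hook\<close>
    have "Min S < t" if "t \<in> S - {Min S}" for t
      using that le_S[of t] by auto
    then have "\<not> (\<exists>t\<in>S - {Min S}. \<forall>m\<in>#add_mset (Min S) M. t \<le> m)"
      by (metis leD union_single_eq_member)
    moreover have "add_mset (Min S) M \<in> multisets_of_size {1..N} (Suc p)"
      using M S in_S by (auto simp: multisets_of_size_def)
    moreover have "S - {Min S} \<subseteq> {1..N}" "card (S - {Min S}) = a"
      using S in_S fin by auto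
    ultimately show "(case q of (M, S) \<Rightarrow> (add_mset (Min S) M, S - {Min S}))
        \<in> ?P (Suc p) a - ?A (Suc p) a"
      unfolding q prod.case mem_Collect_eq Diff_iff by blast
  qed
  finally show ?thesis unfolding hsym_times_esym hook_sum_def .
qed

lemma mem_cells_hook:
  "(r, c) \<in> cells (Suc p # replicate b (Suc 0)) \<longleftrightarrow> r = 0 \<and> c \<le> p \<or> r \<le> b \<and> c = 0"
  by (cases r) (auto simp: cells_def)

lemma cells_hook:
  "cells (Suc p # replicate b (Suc 0)) = (\<lambda>r. (r, 0)) ` {..b} \<union> (\<lambda>c. (0, Suc c)) ` {..<p}"
proof (rule Set.set_eqI)
  fix q :: "nat \<times> nat"
  obtain r c where q: "q = (r, c)" by (cases q)
  show "q \<in> cells (Suc p # replicate b (Suc 0)) \<longleftrightarrow>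
      q \<in> (\<lambda>r. (r, 0)) ` {..b} \<union> (\<lambda>c. (0, Suc c)) ` {..<p}"
    unfolding q mem_cells_hook by (cases c) auto
qed

text \<open>
  A hook tableau is read off as the multiset of its arm and the set of its first column; sorting
  both recovers the tableau. The pair of \<open>M\<close> and \<open>S\<close> comes from a tableau exactly if the first entry
  of the sorted column is at most every entry of the arm.
\<close>

lemma schur_hook: "schur N (Suc p # replicate b (Suc 0)) x = hook_sum N p (Suc b) x"
proof -
  let ?\<mu> = "Suc p # replicate b (Suc 0)"
  let ?row = "\<lambda>T. map (\<lambda>c. T (0, Suc c)) [0..<p] :: nat list"
  let ?col = "\<lambda>T. map (\<lambda>r. T (r, 0::nat)) [0..<Suc b] :: nat list"
  let ?A = "{(M, S). M \<in> multisets_of_size {1..N} p \<and> S \<subseteq> {1..N} \<and> card S = Suc b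
        \<and> (\<exists>s\<in>S. \<forall>m\<in>#M. s \<le> m)}"
  let ?tab = "\<lambda>(M, S). restrict (\<lambda>(r, c). if c = 0 then sorted_list_of_set S ! r
        else sorted_list_of_multiset M ! (c - 1)) (cells ?\<mu>)"
  have "(\<Sum>T\<in>ssyt N ?\<mu>. \<Prod>q\<in>cells ?\<mu>. x (T q)) =
      (\<Sum>(M, S)\<in>?A. (\<Prod>m\<in>#M. x m) * (\<Prod>s\<in>S. x s))"
  proof (rule sum.reindex_bij_witness[where
        j = "\<lambda>T. (mset (?row T), set (?col T))" and i = ?tab])
    fix T assume T: "T \<in> ssyt N ?\<mu>"
    then have T_fun: "T \<in> cells ?\<mu> \<rightarrow>\<^sub>E {1..N}"
      and right: "\<And>c. Suc c \<le> p \<Longrightarrow> T (0, c) \<le> T (0, Suc c)"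
      and down: "\<And>r. Suc r \<le> b \<Longrightarrow> T (r, 0) < T (Suc r, 0)"
      by (auto simp: ssyt_def mem_cells_hook)
    have row_mono: "T (0, c) \<le> T (0, d)" if "c \<le> d" "d \<le> p" for c d
      using that by (induction rule: dec_induct) (auto intro: order_trans right)
    have col_mono: "T (c, 0) < T (d, 0)" if "c < d" "d \<le> b" for c d
      using that
    proof (induction rule: strict_inc_induct)
      case (base i) then show ?case using down[of i] by simp
    next
      case (step i) then show ?case using down[of i] by simp
    qed
    have sorted_row: "sorted (?row T)"
      by (auto simp: sorted_iff_nth_mono intro: row_mono)
    have sorted_col: "sorted_wrt (<) (?col T)"
      unfolding sorted_wrt_iff_nth_less by (auto simp del: upt_Suc intro: col_mono)
    have row_eq: "sorted_list_of_multiset (mset (?row T)) = ?row T"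
      using sorted_row by (simp only: sorted_list_of_multiset_mset sorted_sort_id)
    have col_eq: "sorted_list_of_set (set (?col T)) = ?col T"
      using sorted_col unfolding strict_sorted_iff by (intro sorted_list_of_set.idem_if_sorted_distinct) auto
    show "?tab (mset (?row T), set (?col T)) = T"
    proof (rule extensionalityI[where A = "cells ?\<mu>"])
      show "T \<in> extensional (cells ?\<mu>)" using T_fun by (simp add: PiE_def)
      fix q assume "q \<in> cells ?\<mu>"
      then consider r where "q = (r, 0)" "r \<le> b" | c where "q = (0, Suc c)" "c < p"
        unfolding cells_hook by auto
      then show "?tab (mset (?row T), set (?col T)) q = T q"
        using \<open>q \<in> cells ?\<mu>\<close> unfolding prod.case row_eq col_eq
        by cases (auto simp del: upt_Suc)
    qed simp
    have card: "card (set (?col T)) = Suc b"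
      using sorted_col distinct_card[of "?col T"] by (simp only: strict_sorted_iff length_map length_upt)
    have corner_in: "T (0, 0) \<in> set (?col T)" by (simp del: upt_Suc)
    have corner_le: "\<forall>m\<in>#mset (?row T). T (0, 0) \<le> m" by (auto intro!: row_mono)
    have T_range: "T q \<in> {1..N}" if "q \<in> cells ?\<mu>" for q
      using T_fun that by (rule PiE_mem)
    have ranges: "set (?row T) \<subseteq> {1..N}" "set (?col T) \<subseteq> {1..N}"
      by (auto simp only: set_map set_upt atLeastLessThan_iff less_Suc_eq_le Suc_le_eq mem_cells_hook
          intro!: T_range)
    have "mset (?row T) \<in> multisets_of_size {1..N} p"
      using ranges(1) unfolding multisets_of_size_def by simp
    then show "(mset (?row T), set (?col T)) \<in> ?A"
      using card ranges(2) corner_in corner_le by blast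
    have "(\<Prod>q\<in>cells ?\<mu>. x (T q)) = (\<Prod>r\<le>b. x (T (r, 0))) * (\<Prod>c<p. x (T (0, Suc c)))"
      unfolding cells_hook
      by (subst prod.union_disjoint) (auto simp: prod.reindex inj_on_def)
    also have "(\<Prod>c<m. x (T (0, Suc c))) = (\<Prod>i\<in>#mset (map (\<lambda>c. T (0, Suc c)) [0..<m]). x i)" for m
      by (induction m) (simp_all add: mult.commute)
    also have "(\<Prod>r\<le>b. x (T (r, 0))) = (\<Prod>s\<in>set (?col T). x s)"
    proof -
      have inj: "inj_on (\<lambda>r. T (r, 0)) {..b}"
      proof (rule linorder_inj_onI')
        fix r r' assume "r' \<in> {..b}" "r < r'"
        then have "T (r, 0) < T (r', 0)" by (intro col_mono) auto
        then show "T (r, 0) \<noteq> T (r', 0)" by simp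
      qed
      have "set (?col T) = (\<lambda>r. T (r, 0)) ` {..b}"
        by (simp only: set_map set_upt atLeast0LessThan lessThan_Suc_atMost)
      then show ?thesis using prod.reindex[OF inj, of x] by (simp only: o_def)
    qed
    finally show "(case (mset (?row T), set (?col T)) of (M, S) \<Rightarrow> (\<Prod>m\<in>#M. x m) * (\<Prod>s\<in>S. x s))
        = (\<Prod>q\<in>cells ?\<mu>. x (T q))" by (simp only: prod.case mult.commute)
  next
    fix q assume "q \<in> ?A"
    then obtain M S s where q: "q = (M, S)" and M: "set_mset M \<subseteq> {1..N}" "size M = p"
      and S: "S \<subseteq> {1..N}" "card S = Suc b" and s: "s \<in> S" "\<And>m. m \<in># M \<Longrightarrow> s \<le> m"
      by (auto simp: multisets_of_size_def)
    have fin: "finite S" using S finite_subset by blast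
    define xs ys where "xs = sorted_list_of_multiset M" and "ys = sorted_list_of_set S"
    have xs: "sorted xs" "mset xs = M" "length xs = p"
      using M unfolding xs_def by (auto simp flip: size_mset)
    have ys: "sorted_wrt (<) ys" "set ys = S" "length ys = Suc b"
      using S fin unfolding ys_def by auto
    \<comment> \<open>\<open>s\<close> may be any entry of the column, and the corner is at most \<open>s\<close>\<close>
    have corner: "ys ! 0 \<le> m" if "m \<in># M" for m
    proof -
      obtain i where "s = ys ! i" "i < length ys" using s ys by (metis in_set_conv_nth)
      then have "ys ! 0 \<le> s" using ys(1) by (metis gr0I le_refl less_imp_le sorted_wrt_nth_less)
      with s(2)[OF that] show ?thesis by simp
    qed
    have row: "?row (?tab q) = xs"
      using xs by (intro nth_equalityI) (auto simp: q xs_def mem_cells_hook)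
    have col: "?col (?tab q) = ys"
      using ys by (intro nth_equalityI) (auto simp: q ys_def mem_cells_hook simp del: upt_Suc)
    show "(mset (?row (?tab q)), set (?col (?tab q))) = q"
      unfolding row col using xs ys q by simp
    have tab0: "?tab q (r, 0) = ys ! r" if "r \<le> b" for r
      using that by (simp add: q ys_def mem_cells_hook)
    have tabS: "?tab q (0, Suc c) = xs ! c" if "c < p" for c
      using that by (simp add: q xs_def mem_cells_hook)
    have "?tab q \<in> cells ?\<mu> \<rightarrow>\<^sub>E {1..N}"
    proof
      fix u assume "u \<in> cells ?\<mu>"
      then consider r where "u = (r, 0)" "r \<le> b" | c where "u = (0, Suc c)" "c < p"
        unfolding cells_hook by auto
      then show "?tab q u \<in> {1..N}"
      proof cases
        case 1
        then have "?tab q u \<in> S" using tab0 ys(2,3) nth_mem[of r ys] by simp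
      then show ?thesis using S by blast
      next
        case 2
        then have "?tab q u \<in># M" using tabS xs(2,3) nth_mem_mset[of c xs] by simp
      then show ?thesis using M by blast
      qed
    qed (auto simp: q)
    moreover have "?tab q (r, c) \<le> ?tab q (r, Suc c)"
      if "(r, c) \<in> cells ?\<mu>" "(r, Suc c) \<in> cells ?\<mu>" for r c
    proof (cases c)
      case 0
      with that have "r = 0" "c < p" by (auto simp: mem_cells_hook)
      then show ?thesis using 0 tab0[of 0] tabS[of 0] corner[of "xs ! 0"] xs by auto
    next
      case (Suc d)
      with that have "r = 0" "Suc d < p" by (auto simp: mem_cells_hook)
      then show ?thesis using Suc tabS[of d] tabS[of "Suc d"] xs 
        by (simp add: sorted_iff_nth_Suc)
    qed
    moreover have "?tab q (r, c) < ?tab q (Suc r, c)"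
      if "(r, c) \<in> cells ?\<mu>" "(Suc r, c) \<in> cells ?\<mu>" for r c
    proof -
      from that have "c = 0" "Suc r \<le> b" by (auto simp: mem_cells_hook)
      then show ?thesis using tab0[of r] tab0[of "Suc r"] ys
        by (simp add: sorted_wrt_iff_nth_less)
    qed
    ultimately show "?tab q \<in> ssyt N ?\<mu>" unfolding ssyt_def by blast
  qed
  then show ?thesis unfolding schur_def hook_sum_def .
qed

section \<open>Generating functions\<close>

definition esym_fps :: "nat \<Rightarrow> (nat \<Rightarrow> 'a::comm_ring_1) \<Rightarrow> 'a fps" where
  "esym_fps N x = Abs_fps (\<lambda>i. esym N (int i) x)"

text \<open>
  The sign stands for the substitution of \<open>-t\<close>, so this is \<open>H(-t)\<close>; in the same way \<open>groth_fps\<close> is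
  \<open>G(-t)\<close>.
\<close>

definition hsym_fps :: "nat \<Rightarrow> (nat \<Rightarrow> 'a::comm_ring_1) \<Rightarrow> 'a fps" where
  "hsym_fps N x = Abs_fps (\<lambda>j. (-1) ^ j * hsym N j x)"

definition groth_fps :: "nat \<Rightarrow> (nat \<Rightarrow> 'a::comm_ring_1) \<Rightarrow> 'a fps" where
  "groth_fps k z = Abs_fps (\<lambda>j. (-1) ^ j * groth k j z)"

text \<open>
  The constant term is \<open>1\<close> and not \<open>cge k 1 z\<close>, because the first summand of \<open>cge'\<close> is
  \<open>e\<^sub>l(\<zeta>)\<close> with the coefficient \<open>1\<close>.
\<close>

definition cge_fps :: "nat \<Rightarrow> (nat \<Rightarrow> 'a::comm_ring_1) \<Rightarrow> 'a fps" where
  "cge_fps k z = Abs_fps (\<lambda>p. if p = 0 then 1 else cge k (Suc p) z)"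

text \<open>
  By Pieri's rule, \<open>h\<^sub>j e\<^bsub>l-j\<^esub>\<close> is the sum of the hooks with \<open>l\<close> cells and the arm
  lengths \<open>j\<close> and \<open>j - 1\<close>. The
  alternating sum over \<open>j \<le> m\<close> therefore telescopes to the hook with arm length \<open>m\<close>, which has no row
  left for \<open>m = l\<close>.
\<close>

lemma hsym_fps_times_esym_fps: "hsym_fps N x * esym_fps N x = 1"
proof (rule fps_ext)
  fix l
  show "(hsym_fps N x * esym_fps N x) $ l = 1 $ l"
  proof (cases "l = 0")
    case True
    then show ?thesis
      by (simp add: hsym_fps_def esym_fps_def hsym_0 esym_0)
  next
    case False
    have "(\<Sum>j = 0..m. (-1) ^ j * hsym N j x * esym N (int (l - j)) x) = (-1) ^ m * hook_sum N m (l - m) x"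
      if "m \<le> l" for m
      using that
    proof (induction m)
      case 0
      then show ?case using False by (simp add: hsym_0 hook_sum_0_left)
    next
      case (Suc m)
      then have "Suc (l - Suc m) = l - m" by simp
      then show ?case using Suc hsym_times_esym_hook[of N m x "l - Suc m"]
        by (simp add: algebra_simps)
    qed
    from this[of l] show ?thesis using False
      by (simp add: fps_mult_nth hsym_fps_def esym_fps_def hook_sum_0_right)
  qed
qed

text \<open>
  Shifting the index costs a sign and nothing else, because a hook with no row or with more than \<open>k\<close>
  rows contributes \<open>0\<close>.
\<close>

lemma alternating_hook_sum:
  "(\<Sum>a\<le>k. (-1) ^ a * hook_sum k p (Suc a) z) =
    - (\<Sum>a\<le>k. (-1) ^ a * hook_sum k p a z)"
proof -
  have "(\<Sum>a\<le>Suc k. (-1) ^ a * hook_sum k p a z) = (\<Sum>a\<le>k. (-1) ^ a * hook_sum k p a z)"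
    by (simp add: hook_sum_eq_0)
  moreover have "(\<Sum>a\<le>Suc k. (-1) ^ a * hook_sum k p a z) = - (\<Sum>a\<le>k. (-1) ^ a * hook_sum k p (Suc a) z)"
    by (subst sum.atMost_Suc_shift) (simp add: hook_sum_0_right sum_negf)
  ultimately show ?thesis by simp
qed

text \<open>
  In the definition of \<open>groth\<close>, the complete symmetric polynomial is the hook with one row, so the
  Grothendieck polynomial is the alternating sum of all hooks with a given arm.
\<close>

lemma groth_Suc_eq_hook_sums:
  "groth k (Suc p) z = (\<Sum>a\<le>k. (-1) ^ a * hook_sum k p (Suc a) z)"
proof -
  have hsym: "hsym k (Suc p) z = hook_sum k p 1 z"
    using hsym_times_esym_hook[of k p z 0] by (simp add: esym_0 hook_sum_0_right)
  have "(\<Sum>a = 2..k. (-1) ^ a * schur k (Suc p # replicate (a - 1) 1) z) =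
      (\<Sum>a = 2..k. (-1) ^ a * hook_sum k p a z)"
  proof (rule sum.cong[OF refl])
    fix a assume "a \<in> {2..k}"
    then have "Suc (a - 1) = a" by auto
    then show "(-1) ^ a * schur k (Suc p # replicate (a - 1) 1) z = (-1) ^ a * hook_sum k p a z"
      using schur_hook[of k p "a - 1" z] by simp
  qed
  moreover have "(\<Sum>a\<le>k. (-1) ^ a * hook_sum k p a z) =
      - hook_sum k p 1 z + (\<Sum>a = 2..k. (-1) ^ a * hook_sum k p a z)"
  proof (cases "k = 0")
    case True
    then show ?thesis by (simp add: hook_sum_0_right hook_sum_eq_0)
  next
    case False
    then have "{..k} = insert 0 (insert 1 {2..k})" by auto
    then show ?thesis by (simp add: hook_sum_0_right)
  qed
  ultimately show ?thesis
    by (simp add: groth_def alternating_hook_sum hsym)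
qed

lemma cge_rec: "cge N j x = esym N (int j) x - cge N (Suc j) x"
proof (cases "j \<le> N")
  case True
  have "(\<Sum>i = Suc j..N. (-1) ^ (i - j) * esym N (int i) x) =
      (\<Sum>i = Suc j..N. - ((-1) ^ (i - Suc j) * esym N (int i) x))"
  proof (rule sum.cong[OF refl])
    fix i assume "i \<in> {Suc j..N}"
    then have "i - j = Suc (i - Suc j)" by auto
    then show "(-1) ^ (i - j) * esym N (int i) x = - ((-1) ^ (i - Suc j) * esym N (int i) x)"
      by simp
  qed
  then show ?thesis
    unfolding cge_def using True by (subst sum.atLeast_Suc_atMost) (simp_all add: sum_negf)
next
  case False
  then show ?thesis by (simp add: cge_def esym_outside)
qed

text \<open>
  Multiply Pieri's rule by \<open>(-1)\<^sup>a\<close> and sum over \<open>a\<close>. The hooks on the right-hand side form two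
  Grothendieck polynomials, and \<open>cge k 0 z\<close> is the full alternating sum of the \<open>e\<^sub>a(z)\<close>, that is, the
  product of all \<open>1 - z\<^sub>i\<close>. Since Pieri's rule in this form concerns \<open>h\<^sub>j\<close> with \<open>j > 0\<close>, the case
  \<open>j = 0\<close> is treated apart.
\<close>

lemma groth_diff: "groth k j z - groth k (Suc j) z = cge k 0 z * hsym k j z"
proof (cases j)
  case 0
  have "cge k 0 z = (\<Sum>a\<le>k. (-1) ^ a * hook_sum k 0 a z + (if a = 0 then 1 else 0))"
    unfolding cge_def atLeast0AtMost
    by (intro sum.cong refl) (auto simp: hook_sum_0_left hook_sum_0_right esym_0)
  then show ?thesis
    by (simp add: 0 groth_Suc_eq_hook_sums alternating_hook_sum groth_def[of k 0] hsym_0 sum.distrib)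
next
  case (Suc p)
  have "cge k 0 z * hsym k (Suc p) z =
      (\<Sum>a\<le>k. (-1) ^ a * (hook_sum k (Suc p) a z + hook_sum k p (Suc a) z))"
    unfolding cge_def atLeast0AtMost sum_distrib_right
    by (intro sum.cong refl) (simp add: mult_ac flip: hsym_times_esym_hook)
  then show ?thesis
    by (simp add: Suc groth_Suc_eq_hook_sums alternating_hook_sum[of k "Suc p"] sum.distrib distrib_left)
qed

lemma fps_one_plus_X_nth:
  "((1 + fps_X) * F) $ l = (F :: 'a::comm_ring_1 fps) $ l + (if l = 0 then 0 else F $ (l - 1))"
  by (simp add: distrib_right)

text \<open>
  The coefficients form an arbitrary commutative ring, so cancellation rests on the unit constant
  term of \<open>1 + t\<close> and not on the absence of zero divisors.
\<close>

lemma fps_one_plus_X_cancel: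
  assumes "(1 + fps_X) * F = (1 + fps_X) * (G :: 'a::comm_ring_1 fps)"
  shows "F = G"
proof (rule fps_ext)
  fix l show "F $ l = G $ l"
  proof (induction l)
    case 0
    then show ?case using fps_one_plus_X_nth[of F 0] fps_one_plus_X_nth[of G 0] assms by simp
  next
    case (Suc l)
    then show ?case
      using fps_one_plus_X_nth[of F "Suc l"] fps_one_plus_X_nth[of G "Suc l"] assms by simp
  qed
qed

lemma one_plus_X_times_groth_fps:
  "(1 + fps_X) * groth_fps k z = 1 + fps_const (cge k 0 z) * (fps_X * hsym_fps k z)"
proof (rule fps_ext)
  fix l
  show "((1 + fps_X) * groth_fps k z) $ l = (1 + fps_const (cge k 0 z) * (fps_X * hsym_fps k z)) $ l"
  proof (cases l)
    case 0
    then show ?thesis by (simp add: fps_one_plus_X_nth groth_fps_def groth_def)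
  next
    case (Suc j)
    have "(-1) ^ Suc j * groth k (Suc j) z + (-1) ^ j * groth k j z = (-1) ^ j * (cge k 0 z * hsym k j z)"
      unfolding groth_diff[symmetric] by (simp add: right_diff_distrib)
    with Suc show ?thesis
      by (simp add: fps_one_plus_X_nth groth_fps_def hsym_fps_def mult_ac)
  qed
qed

text \<open>
  The recursion \<open>cge k j z + cge k (j + 1) z = e\<^sub>j\<close> gives the coefficients in degrees above \<open>1\<close>. In degree
  \<open>1\<close> the constant term \<open>1\<close> stands in the place of \<open>cge k 1 z = 1 - cge k 0 z\<close>, which accounts for the
  correction by \<open>cge k 0 z\<close>.
\<close>

lemma one_plus_X_times_cge_fps:
  "(1 + fps_X) * cge_fps k z = esym_fps k z + fps_const (cge k 0 z) * fps_X"
proof (rule fps_ext)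
  fix l
  consider "l = 0" | "l = 1" | j where "l = Suc (Suc j)"
    by (metis One_nat_def not0_implies_Suc)
  then show "((1 + fps_X) * cge_fps k z) $ l = (esym_fps k z + fps_const (cge k 0 z) * fps_X) $ l"
  proof cases
    case 1
    then show ?thesis by (simp add: fps_one_plus_X_nth cge_fps_def esym_fps_def esym_0)
  next
    case 2
    have "cge k 0 z = 1 - esym k 1 z + cge k (Suc (Suc 0)) z"
      using cge_rec[of k 0 z] cge_rec[of k 1 z] by (simp add: esym_0)
    with 2 show ?thesis by (simp add: fps_one_plus_X_nth cge_fps_def esym_fps_def)
  next
    case 3
    then show ?thesis using cge_rec[of k "Suc (Suc j)" z]
      by (simp add: fps_one_plus_X_nth cge_fps_def esym_fps_def fps_X_nth)
  qed
qed

text \<open>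
  Multiplied by \<open>1 + t\<close>, both sides become \<open>E(t) + c t\<close> with \<open>c = cge k 0 z\<close>; on the left this
  uses \<open>H(-t) E(t) = 1\<close>.
\<close>

lemma esym_fps_times_groth_fps: "esym_fps k z * groth_fps k z = cge_fps k z"
proof (rule fps_one_plus_X_cancel)
  have "(1 + fps_X) * (esym_fps k z * groth_fps k z) = esym_fps k z * ((1 + fps_X) * groth_fps k z)"
    by (simp add: mult_ac)
  also have "\<dots> = esym_fps k z + fps_const (cge k 0 z) * fps_X * (hsym_fps k z * esym_fps k z)"
    unfolding one_plus_X_times_groth_fps by (simp add: algebra_simps)
  also have "\<dots> = (1 + fps_X) * cge_fps k z"
    by (simp add: hsym_fps_times_esym_fps one_plus_X_times_cge_fps)
  finally show "(1 + fps_X) * (esym_fps k z * groth_fps k z) = (1 + fps_X) * cge_fps k z" .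
qed

lemma cge'_eq_coeff: "cge' n k l z \<zeta> = (cge_fps k z * esym_fps n \<zeta>) $ l"
proof -
  let ?f = "\<lambda>p. esym n (int l - int p) \<zeta> * cge k (Suc p) z"
  have shift: "int l - int (m - 1) = int l - int m + 1" if "2 \<le> m" for m
    using that by simp
  have "(\<Sum>m = 2..k. esym n (int l - int m + 1) \<zeta> * cge k m z) = (\<Sum>p \<in> {1..<k}. ?f p)"
    by (rule sum.reindex_bij_witness[of _ Suc "\<lambda>m. m - 1"])
      (auto simp del: of_nat_diff simp: shift[unfolded One_nat_def])
  \<comment> \<open>pass from the range given by \<open>k\<close> to the one given by \<open>l\<close> through a common larger range\<close>
  also have "\<dots> = (\<Sum>p = 1..l + k. ?f p)"
    by (rule sum.mono_neutral_left) (auto simp: cge_def)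
  also have "\<dots> = (\<Sum>p = 1..l. ?f p)"
    by (rule sum.mono_neutral_right) (auto simp: esym_outside)
  also have "\<dots> = (\<Sum>p = 1..l. cge_fps k z $ p * esym_fps n \<zeta> $ (l - p))"
    by (rule sum.cong) (auto simp: cge_fps_def esym_fps_def of_nat_diff)
  also have "esym n (int l) \<zeta> + \<dots> = (cge_fps k z * esym_fps n \<zeta>) $ l"
    unfolding fps_mult_nth by (subst sum.atLeast_Suc_atMost) (simp_all add: cge_fps_def esym_fps_def)
  finally show ?thesis unfolding cge'_def .
qed

lemma sum_pairs_eq:
  "(\<Sum>(i, j) | i + j = (l::nat). f i j) = (\<Sum>i = 0..l. f i (l - i))"
  by (rule sum.reindex_bij_witness[of _ "\<lambda>i. (i, l - i)" fst]) auto

section \<open>The ideal\<close>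

text \<open>
  Division by a power series with constant term \<open>1\<close>: solve \<open>(E F)\<^sub>l = F\<^sub>l + \<Sum>\<^sub>i E\<^sub>i F\<^bsub>l-i\<^esub>\<close> for \<open>F\<^sub>l\<close>
  and argue by induction on \<open>l\<close>. Degrees above \<open>L\<close> never enter. The set \<open>S\<close> is used both as the subring
  \<open>QKpoly\<close> and as the ideal \<open>Jhat\<close>.
\<close>

lemma fps_division_closed:
  fixes E F :: "'a::comm_ring_1 fps"
  assumes "E $ 0 = 1"
    and diff: "\<And>a b. a \<in> S \<Longrightarrow> b \<in> S \<Longrightarrow> a - b \<in> S"
    and mult: "\<And>i a. a \<in> S \<Longrightarrow> E $ i * a \<in> S"
    and prod: "\<And>i. i \<le> L \<Longrightarrow> (E * F) $ i \<in> S"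
    and "l \<le> L"
  shows "F $ l \<in> S"
  using \<open>l \<le> L\<close>
proof (induction l rule: less_induct)
  case (less l)
  have zero: "0 \<in> S" using diff[OF prod[OF le0] prod[OF le0]] by simp
  have add: "a + b \<in> S" if "a \<in> S" "b \<in> S" for a b
    using diff[OF that(1) diff[OF zero that(2)]] by simp
  have "(\<Sum>i\<in>I. E $ i * F $ (l - i)) \<in> S" if "I \<subseteq> {1..l}" for I
    using finite_subset[OF that finite_atLeastAtMost] that
    by (induction I rule: finite_induct) (auto intro!: zero add mult less.IH simp: less.prems[THEN le_trans[rotated]])
  moreover have "(E * F) $ l = F $ l + (\<Sum>i = 1..l. E $ i * F $ (l - i))"
    unfolding fps_mult_nth by (subst sum.atLeast_Suc_atMost) (simp_all add: assms(1))
  ultimately show ?case using diff[OF prod[OF less.prems], of "\<Sum>i = 1..l. E $ i * F $ (l - i)"]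
    by simp
qed

text \<open>
  By definition the Grothendieck polynomials are polynomials in the \<open>z\<^sub>i\<close>. To see that they are
  polynomials in the \<open>e\<^sub>i(z)\<close>, solve \<open>E(t) H(-t) = 1\<close> for the complete symmetric polynomials and apply
  \<open>groth_diff\<close> repeatedly.
\<close>

lemma C_groth: "groth k j zvar \<in> carrier (QKpoly n k)"
proof -
  have "hsym_fps k zvar $ i \<in> carrier (QKpoly n k)" for i
  proof (rule fps_division_closed[of "esym_fps k zvar" _ i])
    show "(esym_fps k zvar * hsym_fps k zvar) $ j \<in> carrier (QKpoly n k)" for j
      by (simp add: mult.commute[of "esym_fps k zvar"] hsym_fps_times_esym_fps C_zero C_one)
  qed (auto simp: esym_fps_def esym_0 intro: C_diff C_mult C_esym_z)
  then have "(-1) ^ i * hsym_fps k zvar $ i \<in> carrier (QKpoly n k)" for i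
    by (rule C_mult[OF C_sign])
  then have hsym: "hsym k i zvar \<in> carrier (QKpoly n k)" for i
    by (simp add: hsym_fps_def)
  show ?thesis
  proof (induction j)
    case 0
    then show ?case by (simp add: groth_def C_one)
  next
    case (Suc j)
    have "groth k (Suc j) zvar = groth k j zvar - cge k 0 zvar * hsym k j zvar"
      using groth_diff[of k j zvar] by (simp add: algebra_simps)
    moreover have "cge k 0 zvar \<in> carrier (QKpoly n k)"
      unfolding cge_def by (intro C_sum C_mult C_sign C_esym_z)
    ultimately show ?case using Suc by (auto intro: C_diff C_mult hsym)
  qed
qed

lemma Jhat_diff: "a \<in> Jhat n k \<Longrightarrow> b \<in> Jhat n k \<Longrightarrow> a - b \<in> Jhat n k"
  and Jhat_mult: "r \<in> carrier (QKpoly n k) \<Longrightarrow> a \<in> Jhat n k \<Longrightarrow> r * a \<in> Jhat n k"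
proof -
  interpret ideal "Jhat n k" "QKpoly n k" by (rule ideal_Jhat)
  show mult: "r * a \<in> Jhat n k" if "r \<in> carrier (QKpoly n k)" "a \<in> Jhat n k" for r a
    using I_l_closed[OF that(2,1)] by simp
  show "a - b \<in> Jhat n k" if "a \<in> Jhat n k" "b \<in> Jhat n k" for a b
    using additive_subgroup.a_closed[OF is_additive_subgroup that(1) mult[OF C_uminus[OF C_one] that(2)]] by simp
qed

text \<open>
  In these degrees the relation is a coefficient of a multiple of \<open>E(t)\<close>, since
  \<open>C(t) = E(t) G(-t)\<close>.
\<close>

lemma QKrel_eq_coeff:
  assumes "l \<le> n - k"
  shows "QKrel n k l =
     (esym_fps k zvar * (esym_fps (n - k) zhat - esym_fps n zeta * groth_fps k zvar)) $ l"
proof -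
  have "(\<Sum>i = 0..l. esym k (int i) zvar * esym (n - k) (int (l - i)) zhat) =
      (esym_fps k zvar * esym_fps (n - k) zhat) $ l"
    by (simp add: fps_mult_nth esym_fps_def)
  then have "QKrel n k l =
      (esym_fps k zvar * esym_fps (n - k) zhat) $ l - (cge_fps k zvar * esym_fps n zeta) $ l"
    using assms unfolding QKrel_def sum_pairs_eq ghat_def by (simp only: cge'_eq_coeff if_True)
  also have "cge_fps k zvar * esym_fps n zeta = esym_fps k zvar * (esym_fps n zeta * groth_fps k zvar)"
    by (simp add: mult_ac flip: esym_fps_times_groth_fps)
  finally show ?thesis by (simp add: right_diff_distrib)
qed

theorem proposition11p6:
  fixes n k l :: nat
  assumes "0 < k" and "k < n" and "1 \<le> l" and "l \<le> n - k"
  shows "cong_Jhat n k (esym (n - k) (int l) zhat)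
           (\<Sum>(i, j) | i + j = l. (-1) ^ j * esym n (int i) zeta * groth k j zvar)
       \<and> (\<Sum>(i, j) | i + j = l. (-1) ^ j * esym n (int i) zeta * groth k j zvar)
           = (-1) ^ l * groth' n k l zvar zeta"
proof
  let ?R = "\<Sum>(i, j) | i + j = l. (-1) ^ j * esym n (int i) zeta * groth k j zvar"
  let ?D = "esym_fps (n - k) zhat - esym_fps n zeta * groth_fps k zvar"
  have R: "?R = (esym_fps n zeta * groth_fps k zvar) $ l"
    unfolding sum_pairs_eq fps_mult_nth
    by (simp add: esym_fps_def groth_fps_def mult_ac)
  have "?R \<in> carrier (QKpoly n k)"
    unfolding sum_pairs_eq by (intro C_sum C_mult C_sign C_esym_zeta C_groth)
  moreover have "?D $ l \<in> Jhat n k"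
  proof (rule fps_division_closed[of "esym_fps k zvar" _ "n - k"])
    fix m assume m: "m \<le> n - k"
    show "(esym_fps k zvar * ?D) $ m \<in> Jhat n k"
    \<comment> \<open>there is no relation in degree \<open>0\<close>, but there both series have the constant term \<open>1\<close>\<close>
    proof (cases "m = 0")
      case True
      interpret ideal "Jhat n k" "QKpoly n k" by (rule ideal_Jhat)
      have "(esym_fps k zvar * ?D) $ m = 0"
        using True by (simp add: esym_fps_def groth_fps_def esym_0 groth_def)
      then show ?thesis using additive_subgroup.zero_closed[OF is_additive_subgroup] by simp
    next
      case False
      interpret cring "QKpoly n k" by (rule cring_QKpoly)
      have "QKrel n k m \<in> {QKrel n k l | l. l \<in> {1..n}}" using m False by auto
      then have "QKrel n k m \<in> Jhat n k"
        unfolding Jhat_def by (intro subsetD[OF genideal_self]) (auto intro: QKrel_in_carrier)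
      then show ?thesis using QKrel_eq_coeff[OF m] by simp
    qed
  next
    show "esym_fps k zvar $ i * a \<in> Jhat n k" if "a \<in> Jhat n k" for i a
      using that unfolding esym_fps_def by (intro Jhat_mult) (simp_all add: C_esym_z)
  qed (use assms in \<open>auto simp: esym_fps_def esym_0 intro: Jhat_diff\<close>)
  then have "esym (n - k) (int l) zhat - ?R \<in> Jhat n k"
    unfolding R by (simp add: esym_fps_def[of "n - k"])
  ultimately show "cong_Jhat n k (esym (n - k) (int l) zhat) ?R"
    unfolding cong_Jhat_def by (simp add: C_esym_zhat)
  show "?R = (-1) ^ l * groth' n k l zvar zeta"
    unfolding groth'_def sum_pairs_eq sum_distrib_left
  proof (rule sum.cong[OF refl])
    fix i assume "i \<in> {0..l}"
    then have "(-1) ^ l = (-1 :: amb) ^ (l - i) * (-1) ^ i" by (simp flip: power_add)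
    then have "(-1) ^ l * (-1) ^ i = (-1 :: amb) ^ (l - i)"
      by (simp add: mult.assoc flip: power_mult_distrib)
    then show "(-1) ^ (l - i) * esym n (int i) zeta * groth k (l - i) zvar =
        (-1) ^ l * ((-1) ^ i * esym n (int i) zeta * groth k (l - i) zvar)"
      by (simp flip: mult.assoc)
  qed
qed

end
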